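(* Let $\mathcal{E}$ be an ellipse with center $O$ and semi-axes $a,b>0$, and let $\theta\in\mathbb{R}$ be fixed. The signed area $A_\theta$ of the rotated pedal curve $\mathcal{E}_\theta$ of $\mathcal{E}$ with respect to a point $M$ is constant as $M$ ranges over any circle centered at $O$ (concentric with $\mathcal{E}$).
   Context: Parametrize $\mathcal{E}$ by $P(t)=(a\cos t,b\sin t)$, $t\in[0,2\pi]$, with center $O=(0,0)$. The rotated pedal curve $\mathcal{E}_\theta$ with respect to $M$ is $t\mapsto Q_\theta(t)$, where $Q_\theta(t)$ is the foot of the perpendicular dropped from $M$ onto the line through $P(t)$ whose direction is the tangent vector $P'(t)$ rotated by the angle $\theta$ (counterclockwise). The signed area of a closed parametrized curve $\gamma$ is $\frac12\int_\gamma(x\,dy-y\,dx)$, with orientation given by increasing $t$. *)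

theory Defs
  imports "HOL-Analysis.Analysis"
begin

definition ellipse :: "real \<Rightarrow> real \<Rightarrow> real \<Rightarrow> real ^ 2" where
  "ellipse a b t = vector [a * cos t, b * sin t]"

text \<open>Counterclockwise for positive angles.\<close>

definition rotate_by :: "real \<Rightarrow> real ^ 2 \<Rightarrow> real ^ 2" where
  "rotate_by \<theta> v =
     vector [cos \<theta> * v $ 1 - sin \<theta> * v $ 2, sin \<theta> * v $ 1 + cos \<theta> * v $ 2]"

definition line_through :: "'a::real_vector \<Rightarrow> 'a \<Rightarrow> 'a set" where
  "line_through p d = {p + s *\<^sub>R d | s. True}"

text \<open>Meaningful only for \<open>d \<noteq> 0\<close>; see \<open>foot_ex1\<close>.\<close>

definition perp_foot :: "'a::real_inner \<Rightarrow> 'a \<Rightarrow> 'a \<Rightarrow> 'a" where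
  "perp_foot m p d = (THE q. q \<in> line_through p d \<and> orthogonal (m - q) d)"

definition rotated_pedal :: "real \<Rightarrow> real \<Rightarrow> real \<Rightarrow> real ^ 2 \<Rightarrow> real \<Rightarrow> real ^ 2" where
  "rotated_pedal a b \<theta> M t =
     perp_foot M (ellipse a b t) (rotate_by \<theta> (vector_derivative (ellipse a b) (at t)))"

definition signed_area :: "real \<Rightarrow> real \<Rightarrow> (real \<Rightarrow> real ^ 2) \<Rightarrow> real" where
  "signed_area u v \<gamma> =
     1 / 2 * integral {u..v} (\<lambda>t.
       \<gamma> t $ 1 * vector_derivative \<gamma> (at t within {u..v}) $ 2
       - \<gamma> t $ 2 * vector_derivative \<gamma> (at t within {u..v}) $ 1)"

text \<open>The description in \<^const>\<open>perp_foot\<close> denotes, and for an ellipse the direction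
  vector never vanishes. The rotated pedal curve is closed and continuously differentiable
  and the integrand in \<^const>\<open>signed_area\<close> is integrable, so no default values
  enter.\<close>

lemma foot_unique:
  fixes m p d q :: "'a::real_inner"
  assumes "d \<noteq> 0"
  shows "q \<in> line_through p d \<and> orthogonal (m - q) d
    \<longleftrightarrow> q = p + (((m - p) \<bullet> d) / (d \<bullet> d)) *\<^sub>R d"
proof -
  have d: "d \<bullet> d \<noteq> 0" using assms by simp
  have "(m - (p + s *\<^sub>R d)) \<bullet> d = 0 \<longleftrightarrow> s = ((m - p) \<bullet> d) / (d \<bullet> d)" for s
    using d by (auto simp: inner_diff_left inner_add_left field_simps)
  then show ?thesis
    unfolding line_through_def orthogonal_def by auto
qed

lemma foot_ex1:
  fixes m p d :: "'a::real_inner"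
  assumes "d \<noteq> 0"
  shows "\<exists>!q. q \<in> line_through p d \<and> orthogonal (m - q) d"
  using foot_unique[OF assms] by auto

lemma perp_foot_eq:
  fixes m p d :: "'a::real_inner"
  assumes "d \<noteq> 0"
  shows "perp_foot m p d = p + (((m - p) \<bullet> d) / (d \<bullet> d)) *\<^sub>R d"
  unfolding perp_foot_def foot_unique[OF assms] by simp

lemma vector2_axis:
  "(vector [x, y] :: real ^ 2) = x *\<^sub>R axis 1 1 + y *\<^sub>R axis 2 1"
  by (simp add: vec_eq_iff forall_2 axis_def)

lemma has_vector_derivative_vector2:
  fixes f g :: "real \<Rightarrow> real"
  assumes "(f has_real_derivative f') F" "(g has_real_derivative g') F"
  shows "((\<lambda>t. vector [f t, g t] :: real ^ 2) has_vector_derivative vector [f', g']) F"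
  unfolding vector2_axis using assms[unfolded has_real_derivative_iff_has_vector_derivative]
    by (intro has_vector_derivative_add
        bounded_linear.has_vector_derivative[OF bounded_linear_scaleR_left])

lemma vector_derivative_ellipse:
  "vector_derivative (ellipse a b) (at t) = vector [- a * sin t, b * cos t]"
proof -
  have "(ellipse a b has_vector_derivative vector [- a * sin t, b * cos t]) (at t)"
    unfolding ellipse_def
    by (rule has_vector_derivative_vector2) (auto intro!: derivative_eq_intros)
  then show ?thesis by (rule vector_derivative_at)
qed

lemma norm_rotate_by: "norm (rotate_by \<theta> v) = norm v"
proof -
  have "(cos \<theta> * x - sin \<theta> * y)\<^sup>2 + (sin \<theta> * x + cos \<theta> * y)\<^sup>2 = x\<^sup>2 + y\<^sup>2" for x y :: real
  proof -
    have "(cos \<theta> * x - sin \<theta> * y)\<^sup>2 + (sin \<theta> * x + cos \<theta> * y)\<^sup>2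
        = ((sin \<theta>)\<^sup>2 + (cos \<theta>)\<^sup>2) * (x\<^sup>2 + y\<^sup>2)"
      by algebra
    then show ?thesis by simp
  qed
  then show ?thesis
    by (simp add: norm_vec_def L2_set_def sum_2 rotate_by_def)
qed

lemma ellipse_direction_nonzero:
  assumes "a > 0" "b > 0"
  shows "rotate_by \<theta> (vector_derivative (ellipse a b) (at t)) \<noteq> 0"
proof -
  have "vector_derivative (ellipse a b) (at t) \<noteq> 0"
  proof
    assume "vector_derivative (ellipse a b) (at t) = 0"
    then have "- a * sin t = 0" "b * cos t = 0"
      unfolding vector_derivative_ellipse by (auto simp: vec_eq_iff forall_2)
    then have "sin t = 0" "cos t = 0" using assms by auto
    then show False using sin_cos_squared_add[of t] by simp
  qed
  then show ?thesis using norm_rotate_by by (metis norm_eq_zero)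
qed

lemma rotated_pedal_closed: "rotated_pedal a b \<theta> M (2 * pi) = rotated_pedal a b \<theta> M 0"
  by (simp add: rotated_pedal_def vector_derivative_ellipse ellipse_def)

lemma rotated_pedal_C1:
  assumes "a > 0" "b > 0"
  shows "rotated_pedal a b \<theta> M C1_differentiable_on S"
proof -
  define d where "d t = rotate_by \<theta> (vector [- a * sin t, b * cos t])" for t
  have nz: "d t \<noteq> 0" for t
    using ellipse_direction_nonzero[OF assms, of \<theta> t]
    by (simp add: d_def vector_derivative_ellipse)
  define d' where "d' t = rotate_by \<theta> (vector [- a * cos t, - b * sin t])" for t
  define p' :: "real \<Rightarrow> real ^ 2" where "p' t = vector [- a * sin t, b * cos t]" for t
  have eq: "rotated_pedal a b \<theta> M =
      (\<lambda>t. ellipse a b t + (((M - ellipse a b t) \<bullet> d t) / (d t \<bullet> d t)) *\<^sub>R d t)"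
    using perp_foot_eq[OF nz] by (simp add: fun_eq_iff rotated_pedal_def vector_derivative_ellipse d_def)
  have p: "(ellipse a b has_vector_derivative p' t) (at t)" for t
    unfolding ellipse_def p'_def
    by (rule has_vector_derivative_vector2) (auto intro!: derivative_eq_intros)
  have dd: "(d has_vector_derivative d' t) (at t)" for t
    unfolding d_def d'_def rotate_by_def
    by (rule has_vector_derivative_vector2) (auto intro!: derivative_eq_intros)
  have v2: "continuous_on S (\<lambda>t. vector [f t, g t] :: real ^ 2)"
    if "continuous_on S f" "continuous_on S g" for f g :: "real \<Rightarrow> real"
    unfolding vector2_axis using that by (intro continuous_intros)
  have cp: "continuous_on S (ellipse a b)" "continuous_on S p'" "continuous_on S d"
    "continuous_on S d'"
    unfolding ellipse_def p'_def d_def d'_def rotate_by_def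
    by (auto intro!: v2 continuous_intros)
  define n where "n t = (M - ellipse a b t) \<bullet> d t" for t
  define n' where "n' t = (M - ellipse a b t) \<bullet> d' t + (- p' t) \<bullet> d t" for t
  have nd: "(n has_real_derivative n' t) (at t)" for t
    unfolding n_def n'_def has_real_derivative_iff_has_vector_derivative
    by (rule bounded_bilinear.has_vector_derivative[OF bounded_bilinear_inner _ dd])
      (auto intro!: derivative_eq_intros p)
  define m where "m t = d t \<bullet> d t" for t
  define m' where "m' t = d t \<bullet> d' t + d' t \<bullet> d t" for t
  have md: "(m has_real_derivative m' t) (at t)" for t
    unfolding m_def m'_def has_real_derivative_iff_has_vector_derivative
    by (rule bounded_bilinear.has_vector_derivative[OF bounded_bilinear_inner dd dd])
  have mnz: "m t \<noteq> 0" for t using nz by (simp add: m_def)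
  have q: "((\<lambda>t. n t / m t) has_real_derivative
      (n' t * m t - n t * m' t) / (m t * m t)) (at t)" for t
    by (rule DERIV_divide[OF nd md mnz])
  have cn: "continuous_on S n" "continuous_on S n'" "continuous_on S m" "continuous_on S m'"
    unfolding n_def n'_def m_def m'_def by (intro continuous_intros cp)+
  have "(rotated_pedal a b \<theta> M has_vector_derivative
      p' t + ((n t / m t) *\<^sub>R d' t + ((n' t * m t - n t * m' t) / (m t * m t)) *\<^sub>R d t)) (at t)" for t
    unfolding eq n_def[symmetric] m_def[symmetric]
    by (intro has_vector_derivative_add p has_vector_derivative_scaleR q dd)
  moreover have "continuous_on S (\<lambda>t. p' t + ((n t / m t) *\<^sub>R d' t
      + ((n' t * m t - n t * m' t) / (m t * m t)) *\<^sub>R d t))"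
    using mnz by (intro continuous_intros cp cn) auto
  ultimately show ?thesis
    unfolding C1_differentiable_on_def
    by (intro exI[where x = "\<lambda>t. p' t + ((n t / m t) *\<^sub>R d' t
      + ((n' t * m t - n t * m' t) / (m t * m t)) *\<^sub>R d t)"]) simp
qed

lemma signed_area_integrable:
  fixes \<gamma> :: "real \<Rightarrow> real ^ 2"
  assumes "u < v" and "\<gamma> C1_differentiable_on {u..v}"
  shows "(\<lambda>t. \<gamma> t $ 1 * vector_derivative \<gamma> (at t within {u..v}) $ 2
    - \<gamma> t $ 2 * vector_derivative \<gamma> (at t within {u..v}) $ 1) integrable_on {u..v}"
proof -
  obtain D where D: "\<And>t. t \<in> {u..v} \<Longrightarrow> (\<gamma> has_vector_derivative D t) (at t)"
    "continuous_on {u..v} D"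
    using assms(2) unfolding C1_differentiable_on_def by blast
  have vd: "vector_derivative \<gamma> (at t within {u..v}) = D t" if "t \<in> {u..v}" for t
    using has_vector_derivative_at_within[OF D(1)[OF that]] assms(1) that
    by (metis cbox_interval vector_derivative_within_cbox)
  have c: "continuous_on {u..v} \<gamma>"
    using D(1) has_vector_derivative_continuous
    by (intro continuous_at_imp_continuous_on) blast
  have "(\<lambda>t. \<gamma> t $ 1 * D t $ 2 - \<gamma> t $ 2 * D t $ 1) integrable_on {u..v}"
    by (intro integrable_continuous_real continuous_intros c D(2))
  then show ?thesis by (rule integrable_eq) (simp add: vd)
qed

end

theory Submission
  imports Defs
begin

text \<open>
  Let \<open>u = (c, s)\<close> be the unit direction of the line through \<open>P(t)\<close>, let \<open>n = (- s, c)\<close> be its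
  unit normal and \<open>h = P \<bullet> n\<close> the signed distance of the line from \<open>O\<close>. The foot of the
  perpendicular from \<open>M\<close> is \<open>Q = (M \<bullet> u) u + h n\<close>, and the frame obeys \<open>u' = \<omega> n\<close>,
  \<open>n' = - \<omega> u\<close>. Writing \<open>m = M \<bullet> u\<close> and \<open>k = M \<bullet> n\<close>, so that \<open>m' = \<omega> k\<close> and \<open>k' = - \<omega> m\<close>,
  the area integrand \<open>x y' - y x'\<close> of \<open>Q\<close> is
  \<open>(m\<^sup>2 + h\<^sup>2) \<omega> + m h' - h m' = (|M|\<^sup>2 / 2 + h\<^sup>2) \<omega> - 2 h k \<omega> + (m h - m k / 2)'\<close>.
  The last term integrates to zero because \<open>u\<close> and \<open>h\<close> have period \<open>2 \<pi>\<close>. The middle term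
  integrates to zero because the ellipse is symmetric about \<open>O\<close>: replacing \<open>t\<close> by \<open>t + \<pi>\<close>
  reverses \<open>P\<close>, \<open>u\<close> and \<open>n\<close>, hence preserves \<open>h\<close> and \<open>\<omega>\<close> and changes the sign of \<open>k\<close>.
  What remains depends on \<open>M\<close> only through \<open>|M|\<close>. The rotation by \<open>\<theta>\<close> turns the frame
  rigidly and leaves all these properties intact. Beyond the frame equations the argument uses
  only the central symmetry, and \<open>signed_area_feet_on_symmetric_lines\<close> states it for such a
  family of lines; \<open>ellipse_tangent_frame\<close> supplies the frame equations of the ellipse, with
  \<open>\<omega> = a b / |P'|\<^sup>2\<close>.
\<close>

lemma integral_antiperiodic:
  fixes f :: "real \<Rightarrow> real"
  assumes "0 \<le> T" and cont: "continuous_on UNIV f" and anti: "\<And>t. f (t + T) = - f t"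
  shows "integral {0..2 * T} f = 0"
proof -
  have "integral {0..2 * T} f = integral {0..T} f + integral {T..2 * T} f"
    using \<open>0 \<le> T\<close>
    by (intro Henstock_Kurzweil_Integration.integral_combine[symmetric]
        integrable_continuous_real continuous_on_subset[OF cont]) auto
  also have "integral {T..2 * T} f = integral {0..T} (\<lambda>t. f (t + T))"
    using integral_shift_real_ivl[of T T "2 * T" f] by simp
  finally show ?thesis by (simp add: anti)
qed

text \<open>
  In the frame \<open>u = (c, s)\<close>, \<open>n = (- s, c)\<close> the foot has the component of \<open>m\<close> along \<open>u\<close> and
  the component of \<open>p\<close> along \<open>n\<close>, which is \<open>h\<close>.
\<close>

lemma perp_foot_unit_direction:
  fixes p m :: "real ^ 2"
  assumes "\<rho> \<noteq> 0" and unit: "c\<^sup>2 + s\<^sup>2 = 1"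
  defines "h \<equiv> c * p $ 2 - s * p $ 1"
  shows "perp_foot m p (vector [\<rho> * c, \<rho> * s]) =
    vector [(m $ 1 * c + m $ 2 * s) * c - h * s, (m $ 1 * c + m $ 2 * s) * s + h * c]"
proof -
  let ?d = "vector [\<rho> * c, \<rho> * s] :: real ^ 2"
  have dd: "?d \<bullet> ?d = \<rho>\<^sup>2"
  proof -
    have "?d \<bullet> ?d = \<rho>\<^sup>2 * (c\<^sup>2 + s\<^sup>2)"
      by (simp add: inner_vec_def sum_2 power2_eq_square algebra_simps)
    then show ?thesis by (simp add: unit)
  qed
  then have "?d \<noteq> 0" using \<open>\<rho> \<noteq> 0\<close> by auto
  define l where "l = (m $ 1 - p $ 1) * c + (m $ 2 - p $ 2) * s"
  have "(m - p) \<bullet> ?d = \<rho> * l"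
    by (simp add: l_def inner_vec_def sum_2 algebra_simps)
  then have coeff: "(m - p) \<bullet> ?d / (?d \<bullet> ?d) = l / \<rho>"
    using \<open>\<rho> \<noteq> 0\<close> by (simp add: dd power2_eq_square)
  have step: "p + ((m - p) \<bullet> ?d / (?d \<bullet> ?d)) *\<^sub>R ?d = vector [p $ 1 + l * c, p $ 2 + l * s]"
    unfolding coeff using \<open>\<rho> \<noteq> 0\<close> by (simp add: vec_eq_iff forall_2)
  have "p $ 1 + l * c = (m $ 1 * c + m $ 2 * s) * c - h * s"
    "p $ 2 + l * s = (m $ 1 * c + m $ 2 * s) * s + h * c"
    using unit unfolding l_def h_def by algebra+
  with step show ?thesis
    by (simp add: perp_foot_eq[OF \<open>?d \<noteq> 0\<close>])
qed

text \<open>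
  The curve is the locus of the feet of the perpendiculars from \<open>M\<close> to the lines
  \<open>{x. x \<bullet> (- s, c) = h}\<close>; the hypotheses on \<open>t + T\<close> say that the line at \<open>t + T\<close> is the
  reflection in the origin of the line at \<open>t\<close>. The symmetry kills the part of the area that is
  linear in \<open>M\<close>, and the quadratic part is a multiple of the squared norm because
  \<open>(M \<bullet> u)\<^sup>2 \<omega>\<close> and \<open>(M \<bullet> n)\<^sup>2 \<omega>\<close> differ by the derivative of a periodic function.
\<close>

lemma signed_area_feet_on_symmetric_lines:
  fixes c s h h' \<omega> :: "real \<Rightarrow> real" and M :: "real ^ 2"
  assumes "0 < T"
    and dc: "\<And>t. (c has_real_derivative - \<omega> t * s t) (at t)"
    and ds: "\<And>t. (s has_real_derivative \<omega> t * c t) (at t)"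
    and dh: "\<And>t. (h has_real_derivative h' t) (at t)"
    and cont: "continuous_on UNIV \<omega>"
    and unit: "\<And>t. (c t)\<^sup>2 + (s t)\<^sup>2 = 1"
    and sym: "\<And>t. c (t + T) = - c t" "\<And>t. s (t + T) = - s t"
      "\<And>t. h (t + T) = h t" "\<And>t. \<omega> (t + T) = \<omega> t"
  shows "signed_area 0 (2 * T) (\<lambda>t. vector
      [(M $ 1 * c t + M $ 2 * s t) * c t - h t * s t,
       (M $ 1 * c t + M $ 2 * s t) * s t + h t * c t])
    = 1 / 2 * integral {0..2 * T} (\<lambda>t. ((norm M)\<^sup>2 / 2 + (h t)\<^sup>2) * \<omega> t)"
proof -
  define m where "m t = M $ 1 * c t + M $ 2 * s t" for t
  define k where "k t = M $ 2 * c t - M $ 1 * s t" for t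
  define x where "x t = m t * c t - h t * s t" for t
  define y where "y t = m t * s t + h t * c t" for t
  define x' where "x' t = (\<omega> t * k t - h t * \<omega> t) * c t - (m t * \<omega> t + h' t) * s t" for t
  define y' where "y' t = (\<omega> t * k t - h t * \<omega> t) * s t + (m t * \<omega> t + h' t) * c t" for t
  define \<gamma> :: "real \<Rightarrow> real ^ 2" where "\<gamma> t = vector [x t, y t]" for t
  \<comment> \<open>The integrand will be \<open>E - L + G'\<close>: \<open>E\<close> sees only the norm of \<open>M\<close>, \<open>L\<close> changes sign under
    \<open>t \<mapsto> t + T\<close>, and \<open>G\<close> has period \<open>2 * T\<close>.\<close>
  define G where "G t = m t * h t - m t * k t / 2" for t
  define E where "E t = ((norm M)\<^sup>2 / 2 + (h t)\<^sup>2) * \<omega> t" for t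
  define L where "L t = 2 * h t * k t * \<omega> t" for t
  define G' where
    "G' t = \<omega> t * k t * h t + m t * h' t - (\<omega> t * (k t)\<^sup>2 - \<omega> t * (m t)\<^sup>2) / 2" for t
  have dm: "(m has_real_derivative \<omega> t * k t) (at t)" for t
    unfolding m_def k_def
    by (rule derivative_eq_intros dc ds refl | simp add: algebra_simps)+
  have dk: "(k has_real_derivative - \<omega> t * m t) (at t)" for t
    unfolding m_def k_def
    by (rule derivative_eq_intros dc ds refl | simp add: algebra_simps)+
  have dx: "(x has_real_derivative x' t) (at t)" for t
    unfolding x_def x'_def
    by (rule derivative_eq_intros dm dc ds dh refl | simp add: algebra_simps)+
  have dy: "(y has_real_derivative y' t) (at t)" for t
    unfolding y_def y'_def
    by (rule derivative_eq_intros dm dc ds dh refl | simp add: algebra_simps)+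
  have dG: "(G has_real_derivative G' t) (at t)" for t
    unfolding G_def
    by (rule DERIV_cong[OF DERIV_diff[OF DERIV_mult[OF dm dh] DERIV_cdivide[OF DERIV_mult[OF dm dk]]]])
      (unfold G'_def, algebra)
  have cont_of_deriv: "continuous_on S f"
    if "\<And>t. (f has_real_derivative f' t) (at t)" for S and f f' :: "real \<Rightarrow> real"
    using that by (meson DERIV_isCont continuous_at_imp_continuous_on)
  note conts = cont_of_deriv[OF dk] cont_of_deriv[OF dh] continuous_on_subset[OF cont]
  have E_int: "E integrable_on {0..2 * T}" and L_int: "L integrable_on {0..2 * T}"
    unfolding E_def L_def
    by (auto intro!: integrable_continuous_real continuous_intros conts)
  have period: "c (2 * T) = c 0" "s (2 * T) = s 0" "h (2 * T) = h 0"
  proof -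
    have "2 * T = 0 + T + T" by simp
    then show "c (2 * T) = c 0" "s (2 * T) = s 0" "h (2 * T) = h 0"
      by (simp_all only: sym minus_minus)
  qed
  have G_int: "(G' has_integral 0) {0..2 * T}"
  proof -
    have "(G' has_integral G (2 * T) - G 0) {0..2 * T}"
      using \<open>0 < T\<close> dG
      by (intro fundamental_theorem_of_calculus)
        (auto simp: has_real_derivative_iff_has_vector_derivative[symmetric]
          intro: has_field_derivative_at_within)
    then show ?thesis by (simp add: G_def m_def k_def period)
  qed
  have L_zero: "integral {0..2 * T} L = 0"
  proof -
    have L_cont: "continuous_on UNIV L"
      unfolding L_def by (auto intro!: continuous_intros conts)
    have L_anti: "L (t + T) = - L t" for t
    proof -
      have "k (t + T) = - k t" unfolding k_def sym by simp
      then show ?thesis unfolding L_def sym by simp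
    qed
    show ?thesis
      by (rule integral_antiperiodic[OF less_imp_le[OF \<open>0 < T\<close>] L_cont L_anti])
  qed
  have deriv: "vector_derivative \<gamma> (at t within {0..2 * T}) = vector [x' t, y' t]"
    if "t \<in> {0..2 * T}" for t
  proof -
    have "(\<gamma> has_vector_derivative vector [x' t, y' t]) (at t within {0..2 * T})"
      unfolding \<gamma>_def
      by (rule has_vector_derivative_at_within[OF has_vector_derivative_vector2[OF dx dy]])
    then show ?thesis
      using vector_derivative_within_cbox[of 0 "2 * T" t \<gamma>] \<open>0 < T\<close> that by simp
  qed
  have norm_M: "(norm M)\<^sup>2 = (m t)\<^sup>2 + (k t)\<^sup>2" for t
  proof -
    have "(norm M)\<^sup>2 = (M $ 1)\<^sup>2 + (M $ 2)\<^sup>2"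
      by (simp add: norm_vec_def L2_set_def sum_2)
    then show ?thesis unfolding m_def k_def using unit[of t] by algebra
  qed
  have integrand: "x t * y' t - y t * x' t = E t - L t + G' t" for t
  proof -
    have "x t * y' t - y t * x' t
        = ((c t)\<^sup>2 + (s t)\<^sup>2) * (m t * (m t * \<omega> t + h' t) - h t * (\<omega> t * k t - h t * \<omega> t))"
      unfolding x_def y_def x'_def y'_def by algebra
    also have "\<dots> = E t - L t + G' t"
      unfolding unit E_def L_def G'_def norm_M[of t]
      by (simp add: power2_eq_square algebra_simps add_divide_distrib diff_divide_distrib)
    finally show ?thesis .
  qed
  have "signed_area 0 (2 * T) \<gamma> = 1 / 2 * integral {0..2 * T} (\<lambda>t. E t - L t + G' t)"
    unfolding signed_area_def integrand[symmetric]
    by (intro arg_cong2[where f = "(*)"] refl Henstock_Kurzweil_Integration.integral_cong)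
      (simp add: deriv, simp add: \<gamma>_def)
  also have "integral {0..2 * T} (\<lambda>t. E t - L t + G' t) = integral {0..2 * T} E"
  proof -
    have "((\<lambda>t. E t - L t + G' t) has_integral integral {0..2 * T} E - 0 + 0) {0..2 * T}"
      using integrable_integral[OF E_int] integrable_integral[OF L_int] G_int
      unfolding L_zero by (intro has_integral_add has_integral_diff)
    then show ?thesis by (simp add: integral_unique)
  qed
  finally show ?thesis
    unfolding \<gamma>_def x_def y_def m_def E_def .
qed

text \<open>
  The unit tangent \<open>P' / |P'|\<close> turns with angular velocity \<open>det (P', P'') / |P'|\<^sup>2\<close>, and for the
  ellipse the determinant is the constant \<open>a b\<close>.
\<close>

lemma ellipse_tangent_frame:
  fixes a b t :: real
  assumes "a > 0" and "b > 0"
  defines "\<rho> \<equiv> \<lambda>t. sqrt ((a * sin t)\<^sup>2 + (b * cos t)\<^sup>2)"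
  shows "\<rho> t > 0"
    and "((\<lambda>t. - a * sin t / \<rho> t) has_real_derivative
        - (a * b / (\<rho> t)\<^sup>2) * (b * cos t / \<rho> t)) (at t)"
    and "((\<lambda>t. b * cos t / \<rho> t) has_real_derivative
        a * b / (\<rho> t)\<^sup>2 * (- a * sin t / \<rho> t)) (at t)"
proof -
  have "sin t \<noteq> 0 \<or> cos t \<noteq> 0"
    using sin_zero_abs_cos_one[of t] by auto
  then have pos: "(a * sin t)\<^sup>2 + (b * cos t)\<^sup>2 > 0"
    using assms by (simp add: sum_power2_gt_zero_iff)
  then show \<rho>: "\<rho> t > 0" by (simp add: \<rho>_def)
  have sq: "(\<rho> t)\<^sup>2 = (a * sin t)\<^sup>2 + (b * cos t)\<^sup>2"
    using pos by (simp add: \<rho>_def)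
  have d\<rho>: "(\<rho> has_real_derivative (a\<^sup>2 - b\<^sup>2) * sin t * cos t / \<rho> t) (at t)"
    unfolding \<rho>_def using pos
    by (auto intro!: derivative_eq_intros simp: field_simps power2_eq_square)
  \<comment> \<open>The numerators in the quotient rule collapse by \<open>sin\<^sup>2 + cos\<^sup>2 = 1\<close>.\<close>
  have "- a * cos t * \<rho> t - (- a * sin t) * ((a\<^sup>2 - b\<^sup>2) * sin t * cos t / \<rho> t)
      = - (a * b / (\<rho> t)\<^sup>2) * (b * cos t / \<rho> t) * (\<rho> t * \<rho> t)"
  proof -
    have "- a * cos t * \<rho> t - (- a * sin t) * ((a\<^sup>2 - b\<^sup>2) * sin t * cos t / \<rho> t)
        = (- a * cos t * (\<rho> t)\<^sup>2 + a * sin t * ((a\<^sup>2 - b\<^sup>2) * sin t * cos t)) / \<rho> t"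
      using \<rho> by (simp add: field_simps power2_eq_square)
    also have "- a * cos t * (\<rho> t)\<^sup>2 + a * sin t * ((a\<^sup>2 - b\<^sup>2) * sin t * cos t) = - a * b * b * cos t"
      unfolding sq using sin_cos_squared_add[of t] by algebra
    also have "(- a * b * b * cos t) / \<rho> t
        = - (a * b / (\<rho> t)\<^sup>2) * (b * cos t / \<rho> t) * (\<rho> t * \<rho> t)"
      using \<rho> by (simp add: field_simps power2_eq_square)
    finally show ?thesis .
  qed
  then show "((\<lambda>t. - a * sin t / \<rho> t) has_real_derivative
        - (a * b / (\<rho> t)\<^sup>2) * (b * cos t / \<rho> t)) (at t)"
    using \<rho> by (intro DERIV_cong[OF DERIV_divide[OF DERIV_cmult[OF DERIV_sin] d\<rho>]])
      (simp_all add: divide_eq_eq)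
  have "- b * sin t * \<rho> t - b * cos t * ((a\<^sup>2 - b\<^sup>2) * sin t * cos t / \<rho> t)
      = a * b / (\<rho> t)\<^sup>2 * (- a * sin t / \<rho> t) * (\<rho> t * \<rho> t)"
  proof -
    have "- b * sin t * \<rho> t - b * cos t * ((a\<^sup>2 - b\<^sup>2) * sin t * cos t / \<rho> t)
        = (- b * sin t * (\<rho> t)\<^sup>2 - b * cos t * ((a\<^sup>2 - b\<^sup>2) * sin t * cos t)) / \<rho> t"
      using \<rho> by (simp add: field_simps power2_eq_square)
    also have "- b * sin t * (\<rho> t)\<^sup>2 - b * cos t * ((a\<^sup>2 - b\<^sup>2) * sin t * cos t) = - a * a * b * sin t"
      unfolding sq using sin_cos_squared_add[of t] by algebra
    also have "(- a * a * b * sin t) / \<rho> t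
        = a * b / (\<rho> t)\<^sup>2 * (- a * sin t / \<rho> t) * (\<rho> t * \<rho> t)"
      using \<rho> by (simp add: field_simps power2_eq_square)
    finally show ?thesis .
  qed
  then show "((\<lambda>t. b * cos t / \<rho> t) has_real_derivative
        a * b / (\<rho> t)\<^sup>2 * (- a * sin t / \<rho> t)) (at t)"
    using \<rho> by (intro DERIV_cong[OF DERIV_divide[OF DERIV_cmult[OF DERIV_cos] d\<rho>]])
      (simp_all add: divide_eq_eq)
qed

theorem corollary3:
  fixes a b \<theta> r :: real
  assumes "a > 0" and "b > 0" and "r > 0"
  shows "(\<lambda>M. signed_area 0 (2 * pi) (rotated_pedal a b \<theta> M)) constant_on sphere 0 r"
proof -
  define \<rho> where "\<rho> t = sqrt ((a * sin t)\<^sup>2 + (b * cos t)\<^sup>2)" for t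
  define \<alpha> where "\<alpha> t = - a * sin t / \<rho> t" for t
  define \<beta> where "\<beta> t = b * cos t / \<rho> t" for t
  define \<omega> where "\<omega> t = a * b / (\<rho> t)\<^sup>2" for t
  define c where "c t = cos \<theta> * \<alpha> t - sin \<theta> * \<beta> t" for t
  define s where "s t = sin \<theta> * \<alpha> t + cos \<theta> * \<beta> t" for t
  define h where "h t = c t * (b * sin t) - s t * (a * cos t)" for t
  note frame = ellipse_tangent_frame[OF assms(1,2), folded \<rho>_def, folded \<alpha>_def \<beta>_def \<omega>_def]
  have \<rho>: "\<rho> t > 0" for t by (rule frame)
  have dc: "(c has_real_derivative - \<omega> t * s t) (at t)" for t
    unfolding c_def s_def
    by (rule derivative_eq_intros frame refl | simp add: algebra_simps)+
  have ds: "(s has_real_derivative \<omega> t * c t) (at t)" for t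
    unfolding c_def s_def
    by (rule derivative_eq_intros frame refl | simp add: algebra_simps)+
  have dh: "(h has_real_derivative
      - \<omega> t * s t * (b * sin t) + c t * (b * cos t)
      - (\<omega> t * c t * (a * cos t) - s t * (a * sin t))) (at t)" for t
    unfolding h_def
    by (rule derivative_eq_intros dc ds refl | simp add: algebra_simps)+
  have unit: "(c t)\<^sup>2 + (s t)\<^sup>2 = 1" for t
  proof -
    have "(\<alpha> t)\<^sup>2 + (\<beta> t)\<^sup>2 = ((a * sin t)\<^sup>2 + (b * cos t)\<^sup>2) / (\<rho> t)\<^sup>2"
      by (simp add: \<alpha>_def \<beta>_def power_divide add_divide_distrib)
    also have "\<dots> = 1"
      using \<rho>[of t] by (simp add: \<rho>_def sum_power2_gt_zero_iff)
    finally show ?thesis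
      unfolding c_def s_def using sin_cos_squared_add[of \<theta>] by algebra
  qed
  have cont: "continuous_on UNIV \<omega>"
  proof -
    have "continuous_on UNIV \<rho>" unfolding \<rho>_def by (intro continuous_intros)
    moreover have "\<rho> t \<noteq> 0" for t using \<rho>[of t] by simp
    ultimately show ?thesis unfolding \<omega>_def by (intro continuous_intros) auto
  qed
  have sym_u: "c (t + pi) = - c t" "s (t + pi) = - s t" for t
    by (simp_all add: c_def s_def \<alpha>_def \<beta>_def \<rho>_def)
  have sym_h: "h (t + pi) = h t" "\<omega> (t + pi) = \<omega> t" for t
    by (simp_all add: h_def sym_u, simp add: \<omega>_def \<rho>_def)
  \<comment> \<open>\<open>(\<alpha>, \<beta>)\<close> is the unit tangent of the ellipse and \<open>(c, s)\<close> its rotation by \<open>\<theta>\<close>.\<close>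
  have pedal: "rotated_pedal a b \<theta> M = (\<lambda>t. vector
      [(M $ 1 * c t + M $ 2 * s t) * c t - h t * s t,
       (M $ 1 * c t + M $ 2 * s t) * s t + h t * c t])" for M
  proof (rule ext)
    fix t
    have "rotate_by \<theta> (vector_derivative (ellipse a b) (at t)) = vector [\<rho> t * c t, \<rho> t * s t]"
      using \<rho>[of t] unfolding vector_derivative_ellipse rotate_by_def c_def s_def \<alpha>_def \<beta>_def
      by (simp add: vec_eq_iff forall_2 field_simps)
    then show "rotated_pedal a b \<theta> M t = vector
      [(M $ 1 * c t + M $ 2 * s t) * c t - h t * s t,
       (M $ 1 * c t + M $ 2 * s t) * s t + h t * c t]"
      using perp_foot_unit_direction[OF _ unit, of "\<rho> t" M "ellipse a b t" t] \<rho>[of t]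
      by (simp add: rotated_pedal_def h_def ellipse_def)
  qed
  have "signed_area 0 (2 * pi) (rotated_pedal a b \<theta> M)
      = 1 / 2 * integral {0..2 * pi} (\<lambda>t. ((norm M)\<^sup>2 / 2 + (h t)\<^sup>2) * \<omega> t)" for M
    unfolding pedal
    by (rule signed_area_feet_on_symmetric_lines[where c = c and s = s and h = h and \<omega> = \<omega>,
        OF pi_gt_zero dc ds dh cont unit sym_u sym_h])
  then show ?thesis
    by (auto simp: constant_on_def
        intro!: exI[of _ "1 / 2 * integral {0..2 * pi} (\<lambda>t. (r\<^sup>2 / 2 + (h t)\<^sup>2) * \<omega> t)"])
qed

end
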